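(* Let $\mathcal{C}=\{f(\mathbf{x}):\mathbf{x}\in\mathcal{E}_0\}\subset\mathbb{R}^n$, where $f$ is a continuous (in general nonlinear) function and $\mathcal{E}_0$ is an ellipsoid. Consider the semi-infinite problem in the variables $\mathbf{P}$ and $\hat{\mathbf{y}}$: $$\min_{\mathbf{P},\hat{\mathbf{y}}}\ \operatorname{logdet}(\mathbf{P})\quad\text{s.t.}\quad (\mathbf{y}-\hat{\mathbf{y}})^T\mathbf{P}^{-1}(\mathbf{y}-\hat{\mathbf{y}})\le n\quad\text{for all } \mathbf{y}\in\mathcal{C},$$ and the problem over measures $\mu$ on $\mathcal{C}\times\{1\}$: $$\max_{\mu}\ \operatorname{logdet}\Big(\int_{\mathcal{C}\times\{1\}}\tilde{\mathbf{y}}\tilde{\mathbf{y}}^T\,d\mu\Big)\quad\text{s.t.}\quad \int_{\mathcal{C}\times\{1\}}d\mu=1,\ \mu\ge 0,$$ where $\tilde{\mathbf{y}}=[\mathbf{y}^T,1]^T$. If $\mu^*$ is an optimal solution of the second problem, then the optimal solution $(\mathbf{P}^*,\hat{\mathbf{y}}^* )$ of the first problem is $$\hat{\mathbf{y}}^*=\int_{\mathcal{C}}\mathbf{y}\,d\mu^*,\qquad \mathbf{P}^*=\int_{\mathcal{C}}\mathbf{y}\mathbf{y}^T\,d\mu^*-\hat{\mathbf{y}}^*(\hat{\mathbf{y}}^* )^T .$$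
   Context: $\mathcal{E}_0=\{\mathbf{x}\in\mathbb{R}^q:(\mathbf{x}-\hat{\mathbf{y}}_0)^T\mathbf{P}_0^{-1}(\mathbf{x}-\hat{\mathbf{y}}_0)\le 1\}$ is an ellipsoid with center $\hat{\mathbf{y}}_0$ and symmetric positive definite shape matrix $\mathbf{P}_0$, and $f:\mathcal{E}_0\to\mathbb{R}^n$ is continuous, so $\mathcal{C}$ is a compact subset of $\mathbb{R}^n$; $n$ is the dimension of the vectors $\mathbf{y}\in\mathcal{C}$. In the first problem, $\hat{\mathbf{y}}\in\mathbb{R}^n$ is the center of the ellipsoid and $\mathbf{P}$ is its shape matrix, ranging over symmetric positive definite $n\times n$ matrices. $\operatorname{logdet}(\mathbf{X})=\log\det\mathbf{X}$ is defined for symmetric positive definite $\mathbf{X}$ only, so positive definiteness of the argument of $\operatorname{logdet}$ is an implicit constraint in both problems. Measures are finite signed regular Borel measures, $\mu\ge0$ means that $\mu$ is a nonnegative measure, and a measure on $\mathcal{C}\times\{1\}$ is identified with a measure on $\mathcal{C}$ via $\mathbf{y}\mapsto[\mathbf{y}^T,1]^T$; integrals of vectors and matrices are taken entrywise. *)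

theory Defs
  imports "HOL-Analysis.Analysis"
begin

definition sym_pos_def :: "real ^ 'n ^ 'n \<Rightarrow> bool" where
  "sym_pos_def A \<longleftrightarrow> transpose A = A \<and> (\<forall>x. x \<noteq> 0 \<longrightarrow> x \<bullet> (A *v x) > 0)"

(* Only meaningful for symmetric positive definite arguments. So positive definiteness of the
   argument is an explicit constraint in both feasibility predicates below. *)
definition logdet :: "real ^ 'n ^ 'n \<Rightarrow> real" where
  "logdet A = ln (det A)"

definition ellipsoid :: "real ^ 'n \<Rightarrow> real ^ 'n ^ 'n \<Rightarrow> (real ^ 'n) set" where
  "ellipsoid c P = {x. (x - c) \<bullet> (matrix_inv P *v (x - c)) \<le> 1}"

definition outer :: "real ^ 'n \<Rightarrow> real ^ 'n \<Rightarrow> real ^ 'n ^ 'n" where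
  "outer x y = (\<chi> i j. x $ i * y $ j)"

definition vec_integral :: "'a measure \<Rightarrow> ('a \<Rightarrow> real ^ 'n) \<Rightarrow> real ^ 'n" where
  "vec_integral M g = (\<chi> i. \<integral>x. g x $ i \<partial>M)"

definition mat_integral :: "'a measure \<Rightarrow> ('a \<Rightarrow> real ^ 'n ^ 'm) \<Rightarrow> real ^ 'n ^ 'm" where
  "mat_integral M G = (\<chi> i j. \<integral>x. G x $ i $ j \<partial>M)"

(* The homogenised vector [y^T, 1]^T; the index type 'n + unit has n + 1 elements, and the
   summand unit is the index of the last coordinate. *)
definition homog :: "real ^ 'n \<Rightarrow> real ^ ('n + unit)" where
  "homog y = (\<chi> k. case k of Inl i \<Rightarrow> y $ i | Inr _ \<Rightarrow> 1)"

definition dehomog :: "real ^ ('n + unit) \<Rightarrow> real ^ 'n" where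
  "dehomog z = (\<chi> i. z $ Inl i)"

(* Nonnegative finite regular Borel measures on the set K. A value of type measure is
   nonnegative, so this is the cone of all mu >= 0 among the finite signed regular Borel
   measures. The sets equation also fixes the underlying space to be K, and the sets
   U \<inter> K with U open are the relatively open subsets of K. *)
definition regular_measure_on :: "'a::topological_space set \<Rightarrow> 'a measure \<Rightarrow> bool" where
  "regular_measure_on K \<mu> \<longleftrightarrow>
     sets \<mu> = sets (restrict_space borel K) \<and> finite_measure \<mu> \<and>
     (\<forall>A\<in>sets \<mu>.
        emeasure \<mu> A = (SUP F\<in>{F. F \<subseteq> A \<and> compact F}. emeasure \<mu> F) \<and>
        emeasure \<mu> A = (INF U\<in>{U. A \<subseteq> U \<and> open U}. emeasure \<mu> (U \<inter> K)))"

(* The measure on C that corresponds to a measure on C x {1} = homog ` C. *)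
definition base_measure ::
  "(real ^ 'n) set \<Rightarrow> (real ^ ('n + unit)) measure \<Rightarrow> (real ^ 'n) measure" where
  "base_measure C \<mu> = distr \<mu> (restrict_space borel C) dehomog"

definition ellipsoid_feasible ::
  "(real ^ 'n) set \<Rightarrow> (real ^ 'n ^ 'n) \<times> (real ^ 'n) \<Rightarrow> bool" where
  "ellipsoid_feasible C = (\<lambda>(P, c). sym_pos_def P \<and>
     (\<forall>y\<in>C. (y - c) \<bullet> (matrix_inv P *v (y - c)) \<le> real CARD('n)))"

definition ellipsoid_optimal ::
  "(real ^ 'n) set \<Rightarrow> (real ^ 'n ^ 'n) \<times> (real ^ 'n) \<Rightarrow> bool" where
  "ellipsoid_optimal C = is_arg_min (\<lambda>(P, c). logdet P) (ellipsoid_feasible C)"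

definition moment_matrix :: "(real ^ 'k) measure \<Rightarrow> real ^ 'k ^ 'k" where
  "moment_matrix \<mu> = mat_integral \<mu> (\<lambda>z. outer z z)"

definition measure_feasible ::
  "(real ^ 'n) set \<Rightarrow> (real ^ ('n + unit)) measure \<Rightarrow> bool" where
  "measure_feasible C \<mu> \<longleftrightarrow>
     regular_measure_on (homog ` C) \<mu> \<and> (\<integral>z. 1 \<partial>\<mu>) = (1::real) \<and>
     sym_pos_def (moment_matrix \<mu>)"

definition measure_optimal ::
  "(real ^ 'n) set \<Rightarrow> (real ^ ('n + unit)) measure \<Rightarrow> bool" where
  "measure_optimal C = is_arg_max (\<lambda>\<mu>. logdet (moment_matrix \<mu>)) (measure_feasible C)"

end

theory Submission
  imports Defs
begin

text \<open>
  Let \<open>M\<close> be the moment matrix of the optimal measure, \<open>m\<close> the mean and \<open>R\<close> the covariance matrix of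
  its base measure. Since the measure has mass 1, \<open>R\<close> is the Schur complement of the last diagonal
  entry of \<open>M\<close>. The proof is a weak duality argument built on the concavity of the log-determinant,
  in the form \<open>logdet Q - logdet P \<le> trace (P\<inverse> Q) - n\<close> with equality only for \<open>P = Q\<close>
  (lemma \<open>logdet_diff_le_trace\<close>). This follows from \<open>ln d \<le> d - 1\<close> once \<open>P\<close> and \<open>Q\<close> are
  diagonalised simultaneously. The inequality is used twice.

  \<^emph>\<open>Feasibility of \<open>(R, m)\<close>.\<close> Moving a fraction \<open>t\<close> of the mass to the point \<open>z = [y, 1]\<close> gives
  the moment matrix \<open>M\<^sub>t = (1 - t) M + t z z\<^sup>T\<close>. Optimality says \<open>logdet M\<^sub>t \<le> logdet M\<close>, so
  \<open>trace (M\<^sub>t\<inverse> M) \<ge> n + 1\<close>. As \<open>(1 - t) M = M\<^sub>t - t z z\<^sup>T\<close>, this rearranges to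
  \<open>z\<^sup>T M\<^sub>t\<inverse> z \<le> n + 1\<close>, and \<open>t \<rightarrow> 0\<close> yields \<open>z\<^sup>T M\<inverse> z \<le> n + 1\<close>
  (lemma \<open>optimal_measure_support_bound\<close>). To make the limit immediate, Cauchy-Schwarz for \<open>M\<^sub>t\<close>
  first turns the bound into one that is polynomial in \<open>t\<close>. Block inversion gives
  \<open>z\<^sup>T M\<inverse> z = 1 + (y - m)\<^sup>T R\<inverse> (y - m)\<close>, so the bound is the ellipsoid constraint at \<open>y\<close>.

  \<^emph>\<open>Optimality and uniqueness.\<close> For a feasible \<open>(P, c)\<close>, integrating the constraint over the
  measure gives \<open>trace (P\<inverse> R) + (m - c)\<^sup>T P\<inverse> (m - c) \<le> n\<close>. With the inequality above,
  \<open>logdet R - logdet P \<le> - (m - c)\<^sup>T P\<inverse> (m - c) \<le> 0\<close>, and equality forces \<open>c = m\<close> and \<open>P = R\<close>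
  (lemma \<open>feasible_ellipsoid_logdet\<close>).
\<close>

section \<open>Positive definite matrices\<close>

lemma sym_pos_defD:
  assumes "sym_pos_def A"
  shows "transpose A = A" "x \<noteq> 0 \<Longrightarrow> 0 < x \<bullet> (A *v x)" "0 \<le> x \<bullet> (A *v x)"
proof -
  show "transpose A = A" using assms by (simp add: sym_pos_def_def)
  show pos: "0 < x \<bullet> (A *v x)" if "x \<noteq> 0" for x using assms that by (simp add: sym_pos_def_def)
  show "0 \<le> x \<bullet> (A *v x)" using pos[of x] by (cases "x = 0") auto
qed

lemma inner_symmetric_matrix:
  fixes A :: "real ^ 'n ^ 'n"
  assumes "transpose A = A"
  shows "x \<bullet> (A *v y) = y \<bullet> (A *v x)"
  by (metis assms dot_lmul_matrix inner_commute transpose_matrix_vector)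

lemma nonneg_quadratic_discriminant:
  fixes a b c :: real
  assumes "\<And>t. 0 \<le> a + 2 * b * t + c * t\<^sup>2"
  shows "b\<^sup>2 \<le> a * c"
proof (cases "c = 0")
  case True
  have "b = 0"
  proof (rule ccontr)
    assume "b \<noteq> 0"
    \<comment> \<open>The linear function takes the value \<open>-1\<close> at this point.\<close>
    then show False using assms[of "- (a + 1) / (2 * b)"] True by (simp add: field_simps)
  qed
  then show ?thesis using True by simp
next
  case False
  have c: "0 \<le> c"
  proof (rule ccontr)
    assume n: "\<not> 0 \<le> c"
    have s: "a + 2 * b * t + c * t\<^sup>2 + (a + 2 * b * (-t) + c * (-t)\<^sup>2) = 2 * (a + c * t\<^sup>2)" for t
      by simp
    have "0 \<le> a + c * t\<^sup>2" for t
    proof -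
      have "0 \<le> 2 * (a + c * t\<^sup>2)"
        unfolding s[symmetric] using assms[of t] assms[of "-t"] by (rule add_nonneg_nonneg)
      then show ?thesis by simp
    qed
    \<comment> \<open>Here \<open>a + c * t\<^sup>2 = -1\<close>.\<close>
    from this[of "sqrt ((a + 1) / (- c))"] have "0 \<le> a + c * ((a + 1) / (- c))"
      using n assms[of 0] by (simp add: divide_nonneg_neg)
    then show False using n by (simp add: field_simps)
  qed
  show ?thesis using assms[of "- b / c"] False c
    by (simp add: field_simps power2_eq_square)
qed

text \<open>
  The restriction to a subspace is what the construction of eigenvectors by successive maximisation
  needs: there the form is known to be nonnegative only on the vectors orthogonal to those already
  found.
\<close>
lemma Cauchy_Schwarz_psd_on_subspace:
  fixes R :: "real ^ 'n ^ 'n"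
  assumes "subspace T" "transpose R = R" "\<And>x. x \<in> T \<Longrightarrow> 0 \<le> x \<bullet> (R *v x)"
    and "x \<in> T" "y \<in> T"
  shows "(x \<bullet> (R *v y))\<^sup>2 \<le> (x \<bullet> (R *v x)) * (y \<bullet> (R *v y))"
proof (rule nonneg_quadratic_discriminant)
  fix t :: real
  have "x + t *\<^sub>R y \<in> T" using assms by (simp add: subspace_add subspace_scale)
  then have "0 \<le> (x + t *\<^sub>R y) \<bullet> (R *v (x + t *\<^sub>R y))" by (rule assms(3))
  also have "\<dots> = x \<bullet> (R *v x) + 2 * (x \<bullet> (R *v y)) * t + y \<bullet> (R *v y) * t\<^sup>2"
    using inner_symmetric_matrix[OF assms(2), of y x]
    by (simp add: matrix_vector_right_distrib matrix_vector_mult_scaleR inner_add_left inner_add_right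
        power2_eq_square algebra_simps)
  finally show "0 \<le> x \<bullet> (R *v x) + 2 * (x \<bullet> (R *v y)) * t + y \<bullet> (R *v y) * t\<^sup>2" .
qed

text \<open>
  The form attains a positive minimum on the unit sphere, and it is homogeneous of degree 2.
\<close>
lemma sym_pos_def_coercive:
  fixes A :: "real ^ 'n ^ 'n"
  assumes "sym_pos_def A"
  obtains c where "0 < c" "\<And>x. c * (norm x)\<^sup>2 \<le> x \<bullet> (A *v x)"
proof -
  have "continuous_on (sphere (0 :: real ^ 'n) 1) (\<lambda>x. x \<bullet> (A *v x))"
    by (intro continuous_intros matrix_vector_mult_linear_continuous_on)
  from continuous_attains_inf[OF compact_sphere _ this] obtain u where u: "u \<in> sphere 0 1"
    "\<And>y. y \<in> sphere 0 1 \<Longrightarrow> u \<bullet> (A *v u) \<le> y \<bullet> (A *v y)"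
    by auto
  show ?thesis
  proof
    show "0 < u \<bullet> (A *v u)" using u(1) by (intro sym_pos_defD(2)[OF assms]) auto
    fix x :: "real ^ 'n"
    show "(u \<bullet> (A *v u)) * (norm x)\<^sup>2 \<le> x \<bullet> (A *v x)"
    proof (cases "x = 0")
      case False
      have "u \<bullet> (A *v u) \<le> (x /\<^sub>R norm x) \<bullet> (A *v (x /\<^sub>R norm x))"
        using False by (intro u(2)) simp
      then show ?thesis using False
        by (simp add: matrix_vector_mult_scaleR field_simps power2_eq_square)
    qed simp
  qed
qed

lemma sym_pos_def_invertible:
  fixes A :: "real ^ 'n ^ 'n"
  assumes "sym_pos_def A"
  shows "invertible A"
proof -
  have "x = 0" if "A *v x = 0" for x
    using sym_pos_defD(2)[OF assms, of x] that by force
  then have "\<exists>B. B ** A = mat 1"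
    using matrix_left_invertible_ker by blast
  then show ?thesis
    using invertible_left_inverse by blast
qed

lemma matrix_inv_both:
  fixes A :: "real ^ 'n ^ 'n"
  assumes "invertible A"
  shows matrix_inv_right: "A ** matrix_inv A = mat 1"
    and matrix_inv_left: "matrix_inv A ** A = mat 1"
proof -
  have "\<exists>A'. A ** A' = mat 1 \<and> A' ** A = mat 1" using assms by (auto simp: invertible_def)
  from someI_ex[OF this, folded matrix_inv_def]
  show "A ** matrix_inv A = mat 1" "matrix_inv A ** A = mat 1" by blast+
qed

lemma mult_matrix_inv_vector:
  fixes A :: "real ^ 'n ^ 'n"
  assumes "invertible A"
  shows "A *v (matrix_inv A *v x) = x"
  using assms by (simp add: matrix_vector_mul_assoc matrix_inv_right)

lemma sym_pos_def_matrix_inv: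
  fixes A :: "real ^ 'n ^ 'n"
  assumes "sym_pos_def A"
  shows "sym_pos_def (matrix_inv A)"
proof -
  note inv = sym_pos_def_invertible[OF assms]
  have "transpose (matrix_inv A) = matrix_inv A"
  proof -
    have "transpose (matrix_inv A) ** A = mat 1"
      using arg_cong[OF matrix_inv_right[OF inv], of transpose]
      by (simp add: matrix_transpose_mul sym_pos_defD(1)[OF assms])
    then have "transpose (matrix_inv A) ** (A ** matrix_inv A) = matrix_inv A"
      by (simp add: matrix_mul_assoc)
    then show ?thesis by (simp add: matrix_inv_right[OF inv])
  qed
  moreover have "0 < x \<bullet> (matrix_inv A *v x)" if "x \<noteq> 0" for x
  proof -
    have "matrix_inv A *v x \<noteq> 0"
      using that mult_matrix_inv_vector[OF inv, of x] by force
    from sym_pos_defD(2)[OF assms this] show ?thesis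
      by (simp add: mult_matrix_inv_vector[OF inv] inner_commute)
  qed
  ultimately show ?thesis by (simp add: sym_pos_def_def)
qed

lemma compact_ellipsoid:
  assumes "sym_pos_def P"
  shows "compact (ellipsoid c P)"
proof -
  obtain e where e: "0 < e" "\<And>x. e * (norm x)\<^sup>2 \<le> x \<bullet> (matrix_inv P *v x)"
    using sym_pos_def_coercive[OF sym_pos_def_matrix_inv[OF assms]] by blast
  have "closed (ellipsoid c P)"
    unfolding ellipsoid_def
    by (intro closed_Collect_le continuous_intros
        continuous_on_compose2[OF matrix_vector_mult_linear_continuous_on[of UNIV]]) auto
  moreover have "ellipsoid c P \<subseteq> cball c (sqrt (1 / e))"
  proof
    fix x assume "x \<in> ellipsoid c P"
    then have "e * (norm (x - c))\<^sup>2 \<le> 1" using e(2)[of "x - c"] by (simp add: ellipsoid_def)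
    then have "(norm (x - c))\<^sup>2 \<le> 1 / e" using e(1) by (simp add: field_simps)
    then show "x \<in> cball c (sqrt (1 / e))" using real_le_rsqrt by (auto simp: dist_norm norm_minus_commute)
  qed
  ultimately show ?thesis
    by (meson bounded_cball bounded_subset compact_eq_bounded_closed)
qed

section \<open>Simultaneous diagonalisation and the log-determinant\<close>

text \<open>
  A partial \<open>P\<close>-orthonormal family of solutions of the generalised eigenvalue problem
  \<open>Q v = d P v\<close>, indexed by any set of coordinates; the case of all coordinates
  diagonalises both matrices. Induction over the index set replaces induction over the dimension,
  which is a type here. The next vector maximises the Rayleigh quotient
  \<open>(x \<bullet> Q x) / (x \<bullet> P x)\<close> on the \<open>P\<close>-orthogonal complement \<open>T\<close> of the
  vectors found so far, and \<open>e\<close> is the maximal value. Then \<open>R = e P - Q\<close> is nonnegative on \<open>T\<close> and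
  vanishes at the maximiser \<open>u\<close>, so \<open>R u\<close> is orthogonal to \<open>T\<close> by Cauchy-Schwarz; it is
  orthogonal to the old vectors because these are eigenvectors. Hence \<open>R u = 0\<close>.
\<close>
lemma simultaneous_eigenvectors:
  fixes P Q :: "real ^ 'n ^ 'n" and I :: "'n set"
  assumes P: "sym_pos_def P" and Q: "transpose Q = Q"
  shows "\<exists>(v :: 'n \<Rightarrow> real ^ 'n) d. (\<forall>i\<in>I. Q *v v i = d i *\<^sub>R (P *v v i)) \<and>
           (\<forall>i\<in>I. \<forall>j\<in>I. v i \<bullet> (P *v v j) = (if i = j then 1 else 0))"
  using finite[of I]
proof (induction I rule: finite_induct)
  case empty
  then show ?case by simp
next
  case (insert k I)
  then obtain v d where eig: "\<And>i. i \<in> I \<Longrightarrow> Q *v v i = d i *\<^sub>R (P *v v i)"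
    and orth: "\<And>i j. i \<in> I \<Longrightarrow> j \<in> I \<Longrightarrow> v i \<bullet> (P *v v j) = (if i = j then 1 else 0)"
    by blast
  note symP = inner_symmetric_matrix[OF sym_pos_defD(1)[OF P]]
  define T where "T = {x. \<forall>i\<in>I. x \<bullet> (P *v v i) = 0}"
  have T: "subspace T" by (auto simp: T_def subspace_def inner_add_left)
  \<comment> \<open>There are fewer than \<open>n\<close> conditions on \<open>T\<close>, so it contains a nonzero vector.\<close>
  have "card I < CARD('n)" using insert.hyps by (intro psubset_card_mono) auto
  moreover have "dim ((\<lambda>i. P *v v i) ` I) \<le> card I"
    by (meson card_image_le dim_le_card' finite_imageI insert.hyps(1) order.trans)
  ultimately obtain w where w: "w \<noteq> 0" "\<And>y. y \<in> span ((\<lambda>i. P *v v i) ` I) \<Longrightarrow> orthogonal w y"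
    using orthogonal_to_subspace_exists[of "(\<lambda>i. P *v v i) ` I"]
    by (metis DIM_cart DIM_real mult.right_neutral order.strict_trans1)
  have wT: "w \<in> T" using w(2) by (auto simp: T_def orthogonal_def span_base)
  let ?K = "T \<inter> sphere 0 1"
  have "w /\<^sub>R norm w \<in> ?K" using w(1) wT T by (simp add: subspace_scale)
  then have ne: "?K \<noteq> {}" by blast
  have P_nonzero: "x \<bullet> (P *v x) \<noteq> 0" if "norm x = 1" for x
    using sym_pos_defD(2)[OF P, of x] that by force
  have K: "compact ?K" by (intro closed_Int_compact closed_subspace T) simp
  have cont: "continuous_on ?K (\<lambda>x. (x \<bullet> (Q *v x)) / (x \<bullet> (P *v x)))"
    by (intro continuous_intros matrix_vector_mult_linear_continuous_on)
       (use P_nonzero in auto)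
  obtain u where u: "u \<in> ?K"
    "\<And>y. y \<in> ?K \<Longrightarrow> (y \<bullet> (Q *v y)) / (y \<bullet> (P *v y)) \<le> (u \<bullet> (Q *v u)) / (u \<bullet> (P *v u))"
    using continuous_attains_sup[OF K ne cont] by blast
  define e where "e = (u \<bullet> (Q *v u)) / (u \<bullet> (P *v u))"
  define R where "R = e *\<^sub>R P - Q"
  have Rv: "R *v x = e *\<^sub>R (P *v x) - Q *v x" for x
    by (simp add: R_def matrix_vector_mult_diff_rdistrib scaleR_matrix_vector_assoc)
  have u0: "u \<noteq> 0" and uT: "u \<in> T" using u(1) by auto
  have Ppos: "0 < u \<bullet> (P *v u)" using u0 by (rule sym_pos_defD(2)[OF P])
  have symR: "transpose R = R"
    using Q sym_pos_defD(1)[OF P] by (simp add: R_def transpose_def vec_eq_iff)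
  have R_nonneg: "0 \<le> x \<bullet> (R *v x)" if "x \<in> T" for x
  proof (cases "x = 0")
    case False
    have "x /\<^sub>R norm x \<in> ?K" using False that T by (simp add: subspace_scale)
    from u(2)[OF this] have "(x \<bullet> (Q *v x)) / (x \<bullet> (P *v x)) \<le> e"
      using False by (simp add: e_def matrix_vector_mult_scaleR)
    then show ?thesis using sym_pos_defD(2)[OF P False]
      by (simp add: Rv inner_diff_right divide_le_eq)
  qed simp
  have "u \<bullet> (R *v u) = 0" using Ppos by (simp add: Rv inner_diff_right e_def)
  then have RT: "x \<bullet> (R *v u) = 0" if "x \<in> T" for x
    using Cauchy_Schwarz_psd_on_subspace[OF T symR R_nonneg that uT] by simp
  have RI: "v i \<bullet> (R *v u) = 0" if "i \<in> I" for i
  proof -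
    have "v i \<bullet> (P *v u) = 0" using uT that symP[of u "v i"] by (simp add: T_def)
    moreover have "v i \<bullet> (Q *v u) = 0"
      using inner_symmetric_matrix[OF Q, of "v i" u] eig[OF that] uT that by (simp add: T_def)
    ultimately show ?thesis by (simp add: Rv inner_diff_right)
  qed
  have "x \<bullet> (R *v u) = 0" for x
  proof -
    \<comment> \<open>The \<open>P\<close>-orthogonal projection of \<open>x\<close> onto the span of the old vectors.\<close>
    let ?x = "\<Sum>i\<in>I. (x \<bullet> (P *v v i)) *\<^sub>R v i"
    have "x - ?x \<in> T"
      by (simp add: T_def inner_diff_left inner_sum_left orth insert.hyps(1) sum.delta if_distrib cong: if_cong)
    from RT[OF this] show ?thesis by (simp add: inner_diff_left inner_sum_left RI)
  qed
  then have "R *v u = 0" using inner_eq_zero_iff by blast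
  then have Qu: "Q *v u = e *\<^sub>R (P *v u)" by (simp add: Rv)
  let ?u = "u /\<^sub>R sqrt (u \<bullet> (P *v u))"
  have uu: "?u \<bullet> (P *v ?u) = 1"
  proof -
    have "?u \<bullet> (P *v ?u) = inverse (sqrt (u \<bullet> (P *v u))) * (inverse (sqrt (u \<bullet> (P *v u))) * (u \<bullet> (P *v u)))"
      by (simp only: matrix_vector_mult_scaleR inner_scaleR_left inner_scaleR_right)
    also have "\<dots> = 1" using Ppos by (simp add: field_simps)
    finally show ?thesis .
  qed
  have uv: "?u \<bullet> (P *v v i) = 0" "v i \<bullet> (P *v ?u) = 0" if "i \<in> I" for i
  proof -
    have "u \<bullet> (P *v v i) = 0" using uT that by (simp add: T_def)
    then show "?u \<bullet> (P *v v i) = 0" by simp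
    then show "v i \<bullet> (P *v ?u) = 0" by (subst symP)
  qed
  have Qu': "Q *v ?u = e *\<^sub>R (P *v ?u)" using Qu by (simp add: matrix_vector_mult_scaleR)
  define v' where "v' = v(k := ?u)"
  define d' where "d' = d(k := e)"
  have new: "v' k = ?u" "d' k = e" by (simp_all add: v'_def d'_def)
  have old: "v' i = v i" "d' i = d i" "i \<noteq> k" if "i \<in> I" for i
    using that insert.hyps(2) by (auto simp: v'_def d'_def)
  have "Q *v v' i = d' i *\<^sub>R (P *v v' i)" if "i \<in> insert k I" for i
  proof (cases "i = k")
    case True
    show ?thesis unfolding True new by (rule Qu')
  next
    case False
    then have i: "i \<in> I" using that by simp
    show ?thesis unfolding old[OF i] by (rule eig[OF i])
  qed
  moreover have "v' i \<bullet> (P *v v' j) = (if i = j then 1 else 0)"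
    if ij: "i \<in> insert k I" "j \<in> insert k I" for i j
  proof -
    consider "i = k" "j = k" | "i = k" "j \<in> I" | "i \<in> I" "j = k" | "i \<in> I" "j \<in> I"
      using ij by blast
    then show ?thesis
    proof cases
      case 1
      show ?thesis unfolding 1 new uu by simp
    next
      case 2
      show ?thesis unfolding 2(1) new old(1)[OF 2(2)] uv(1)[OF 2(2)] using old(3)[OF 2(2)] by simp
    next
      case 3
      show ?thesis unfolding 3(2) new old(1)[OF 3(1)] uv(2)[OF 3(1)] using old(3)[OF 3(1)] by simp
    next
      case 4
      show ?thesis unfolding old(1)[OF 4(1)] old(1)[OF 4(2)] by (rule orth[OF 4])
    qed
  qed
  ultimately show ?case by blast
qed

text \<open>
  In a \<open>P\<close>-orthonormal basis of generalised eigenvectors with eigenvalues \<open>d i\<close>, the left-hand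
  side is \<open>\<Sum> ln (d i)\<close> and the right-hand side is \<open>\<Sum> (d i - 1)\<close>. The terms compare one by one,
  with equality only for \<open>d i = 1\<close>.
\<close>
lemma logdet_diff_le_trace:
  fixes P Q :: "real ^ 'n ^ 'n"
  assumes P: "sym_pos_def P" and Q: "sym_pos_def Q"
  shows "logdet Q - logdet P \<le> trace (matrix_inv P ** Q) - real CARD('n)"
    and "logdet Q - logdet P = trace (matrix_inv P ** Q) - real CARD('n) \<Longrightarrow> P = Q"
proof -
  obtain v :: "'n \<Rightarrow> real ^ 'n" and d where eig: "\<And>i. Q *v v i = d i *\<^sub>R (P *v v i)"
    and orth: "\<And>i j. v i \<bullet> (P *v v j) = (if i = j then 1 else 0)"
    using simultaneous_eigenvectors[OF P sym_pos_defD(1)[OF Q], of UNIV] by auto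
  define V :: "real ^ 'n ^ 'n" where "V = (\<chi> i j. v j $ i)"
  define D :: "real ^ 'n ^ 'n" where "D = (\<chi> i j. if i = j then d i else 0)"
  have VPV: "transpose V ** P ** V = mat 1"
  proof -
    have "(transpose V ** P ** V) $ i $ j = v i \<bullet> (P *v v j)" for i j
      unfolding matrix_mul_assoc[symmetric]
      by (simp add: matrix_matrix_mult_def matrix_vector_mult_def transpose_def V_def inner_vec_def)
    then show ?thesis by (simp add: vec_eq_iff orth mat_def)
  qed
  have QV: "Q ** V = P ** V ** D"
  proof -
    have "(Q ** V) $ i $ j = (Q *v v j) $ i" for i j
      by (simp add: matrix_matrix_mult_def matrix_vector_mult_def V_def)
    moreover have "(P ** V ** D) $ i $ j = (d j *\<^sub>R (P *v v j)) $ i" for i j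
      by (simp add: matrix_matrix_mult_def matrix_vector_mult_def V_def D_def if_distrib sum.delta
          mult.commute cong: if_cong)
    ultimately show ?thesis by (simp add: vec_eq_iff eig)
  qed
  have d_pos: "0 < d i" for i
  proof -
    have "v i \<noteq> 0" using orth[of i i] by auto
    from sym_pos_defD(2)[OF Q this] show ?thesis by (simp add: eig orth)
  qed
  have VV: "matrix_inv V ** V = mat 1" "V ** matrix_inv V = mat 1"
    using VPV invertible_left_inverse matrix_inv_left matrix_inv_right by blast+
  have detP: "(det V)\<^sup>2 * det P = 1"
    using arg_cong[OF VPV, of det] by (simp add: det_mul power2_eq_square mult_ac)
  then have detV: "det V \<noteq> 0" by auto
  have detP_pos: "0 < det P" using detP
    by (metis zero_less_mult_pos zero_less_one zero_less_power2 detV)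
  have "det D = (\<Prod>i\<in>UNIV. d i)"
    by (subst det_diagonal) (auto simp: D_def)
  then have "det Q = det P * (\<Prod>i\<in>UNIV. d i)"
    using arg_cong[OF QV, of det] detV by (simp add: det_mul)
  then have logdets: "logdet Q - logdet P = (\<Sum>i\<in>UNIV. ln (d i))"
    using detP_pos d_pos less_imp_neq[OF d_pos, symmetric]
    by (simp add: logdet_def ln_mult prod_pos ln_prod)
  have PiP: "matrix_inv P ** P = mat 1"
    using sym_pos_def_invertible[OF P] by (rule matrix_inv_left)
  have "matrix_inv P ** Q = matrix_inv P ** (Q ** V) ** matrix_inv V"
    by (simp add: VV flip: matrix_mul_assoc)
  also have "\<dots> = (matrix_inv P ** P) ** (V ** D ** matrix_inv V)"
    by (simp add: QV matrix_mul_assoc)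
  also have "\<dots> = (V ** D) ** matrix_inv V" by (simp add: PiP)
  finally have "trace (matrix_inv P ** Q) = trace (matrix_inv V ** (V ** D))"
    by (metis trace_mul_sym)
  also have "\<dots> = (\<Sum>i\<in>UNIV. d i)" by (simp add: matrix_mul_assoc VV) (simp add: trace_def D_def)
  finally have tr: "trace (matrix_inv P ** Q) - real CARD('n) = (\<Sum>i\<in>UNIV. d i - 1)"
    by (simp add: sum_subtractf)
  have le: "ln (d i) \<le> d i - 1" for i using d_pos by (rule ln_le_minus_one)
  show "logdet Q - logdet P \<le> trace (matrix_inv P ** Q) - real CARD('n)"
    unfolding logdets tr by (intro sum_mono le)
  assume "logdet Q - logdet P = trace (matrix_inv P ** Q) - real CARD('n)"
  then have "(\<Sum>i\<in>UNIV. (d i - 1) - ln (d i)) = 0" unfolding logdets tr by (simp add: sum_subtractf)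
  then have "\<forall>i. (d i - 1) - ln (d i) = 0"
    using le by (subst (asm) sum_nonneg_eq_0_iff) auto
  then have "d i = 1" for i using ln_eq_minus_one[OF d_pos[of i]] by simp
  then have "D = mat 1" by (simp add: D_def mat_def vec_eq_iff)
  then have "Q ** V ** matrix_inv V = P ** V ** matrix_inv V" using QV by simp
  then show "P = Q" by (simp add: VV flip: matrix_mul_assoc)
qed

lemma outer_vector_mult: "outer x y *v w = (y \<bullet> w) *\<^sub>R x"
  by (simp add: vec_eq_iff matrix_vector_mult_def outer_def inner_vec_def sum_distrib_left mult_ac)

lemma trace_scaleR: "trace (k *\<^sub>R A) = k * trace A" for A :: "real ^ 'n ^ 'n"
  by (simp add: trace_def sum_distrib_left)

lemma trace_mult_outer: "trace (A ** outer x y) = y \<bullet> (A *v x)"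
  by (simp add: trace_def matrix_matrix_mult_def outer_def matrix_vector_mult_def inner_vec_def
      sum_distrib_left mult_ac)

section \<open>Borel measures on compact sets\<close>

text \<open>
  Regularity is automatic for finite Borel measures on a closed subset of a Polish space: push the
  measure forward to the whole space, where inner and outer regularity are known. Closedness of \<open>K\<close>
  makes the measurable subsets of \<open>K\<close> Borel in the whole space.
\<close>
lemma finite_borel_measure_regular_on:
  fixes K :: "'a :: {second_countable_topology, complete_space} set"
  assumes K: "closed K" and sets: "sets \<nu> = sets (restrict_space borel K)" and fin: "finite_measure \<nu>"
  shows "regular_measure_on K \<nu>"
proof -
  interpret finite_measure \<nu> by (rule fin)
  have space: "space \<nu> = K" using sets_eq_imp_space_eq[OF sets] by (simp add: space_restrict_space)
  have incl: "(\<lambda>x. x) \<in> measurable \<nu> borel"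
    unfolding measurable_cong_sets[OF sets refl] by (intro measurable_restrict_space1) simp
  define N where "N = distr \<nu> borel (\<lambda>x. x)"
  have N: "emeasure N B = emeasure \<nu> (B \<inter> K)" if "B \<in> sets borel" for B
    unfolding N_def by (subst emeasure_distr[OF incl that]) (simp add: space vimage_def Int_def)
  have N_fin: "emeasure N (space N) \<noteq> \<infinity>"
    using finite_emeasure_space by (simp add: N_def emeasure_distr incl)
  have setsN: "sets N = sets borel" by (simp add: N_def)
  have "emeasure \<nu> A = (SUP F\<in>{F. F \<subseteq> A \<and> compact F}. emeasure \<nu> F)"
    and "emeasure \<nu> A = (INF U\<in>{U. A \<subseteq> U \<and> open U}. emeasure \<nu> (U \<inter> K))"
    if "A \<in> sets \<nu>" for A
  proof -
    have A: "A \<subseteq> K" "A \<in> sets borel"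
      using that K by (auto simp: sets sets_restrict_space_iff)
    then have NA: "emeasure N A = emeasure \<nu> A" by (simp add: N Int_absorb2)
    have "(SUP F\<in>{F. F \<subseteq> A \<and> compact F}. emeasure N F) = (SUP F\<in>{F. F \<subseteq> A \<and> compact F}. emeasure \<nu> F)"
      using A(1) by (intro SUP_cong refl) (auto simp: N borel_compact intro!: arg_cong[of _ _ "emeasure \<nu>"])
    then show "emeasure \<nu> A = (SUP F\<in>{F. F \<subseteq> A \<and> compact F}. emeasure \<nu> F)"
      using inner_regular[OF setsN N_fin A(2)] NA by simp
    have "(INF U\<in>{U. A \<subseteq> U \<and> open U}. emeasure N U) = (INF U\<in>{U. A \<subseteq> U \<and> open U}. emeasure \<nu> (U \<inter> K))"
      by (intro INF_cong refl) (simp add: N)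
    then show "emeasure \<nu> A = (INF U\<in>{U. A \<subseteq> U \<and> open U}. emeasure \<nu> (U \<inter> K))"
      using outer_regular[OF setsN N_fin A(2)] NA by simp
  qed
  then show ?thesis using sets fin by (simp add: regular_measure_on_def)
qed

text \<open>
  The measure \<open>(1 - t) \<mu> + t \<delta>\<^sub>z\<close>. It is realised as a distribution: draw \<open>x\<close> from \<open>\<mu>\<close>, toss a
  coin independently, and replace \<open>x\<close> by \<open>z\<close> with probability \<open>t\<close>. Fubini then computes its
  integrals.
\<close>
lemma mixture_with_point_mass:
  assumes "finite_measure \<mu>" and mass: "measure \<mu> (space \<mu>) = 1"
    and z: "z \<in> space \<mu>" and t: "0 \<le> t" "t \<le> (1::real)"
  obtains \<nu> where "sets \<nu> = sets \<mu>" "finite_measure \<nu>"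
    "\<And>(g :: _ \<Rightarrow> real) B. g \<in> borel_measurable \<mu> \<Longrightarrow> (\<And>x. x \<in> space \<mu> \<Longrightarrow> \<bar>g x\<bar> \<le> B) \<Longrightarrow>
       (\<integral>x. g x \<partial>\<nu>) = (1 - t) * (\<integral>x. g x \<partial>\<mu>) + t * g z"
proof -
  interpret finite_measure \<mu> by fact
  define coin where "coin = point_measure UNIV (\<lambda>b. ennreal (if b then t else 1 - t))"
  define pick where "pick = (\<lambda>(x, b). if b then z else x)"
  have coin_space: "space coin = UNIV" "sets coin = UNIV"
    by (simp_all add: coin_def space_point_measure sets_point_measure)
  interpret coin: finite_measure coin
    by (rule finite_measureI) (simp add: coin_space, simp add: coin_def emeasure_point_measure_finite2)
  interpret pair_sigma_finite \<mu> coin ..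
  interpret P: finite_measure "\<mu> \<Otimes>\<^sub>M coin"
    by (intro finite_measure_pair_measure) unfold_locales
  have [measurable]: "Measurable.pred coin (\<lambda>b. b)"
    by (simp add: pred_def coin_space)
  have pick[measurable]: "pick \<in> measurable (\<mu> \<Otimes>\<^sub>M coin) \<mu>"
    unfolding pick_def using z by measurable
  let ?\<nu> = "distr (\<mu> \<Otimes>\<^sub>M coin) \<mu> pick"
  show thesis
  proof (rule that[of ?\<nu>])
    show "sets ?\<nu> = sets \<mu>" by simp
    show "finite_measure ?\<nu>" by (rule P.finite_measure_distr) measurable
    fix g :: "_ \<Rightarrow> real" and B
    assume g: "g \<in> borel_measurable \<mu>" and B: "\<And>x. x \<in> space \<mu> \<Longrightarrow> \<bar>g x\<bar> \<le> B"
    have int: "integrable \<mu> g" using B by (intro integrable_const_bound[OF _ g, of B]) auto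
    have "AE w in \<mu> \<Otimes>\<^sub>M coin. norm (g (pick w)) \<le> B"
      using measurable_space[OF pick] B by (intro AE_I2) auto
    then have int2: "integrable (\<mu> \<Otimes>\<^sub>M coin) (\<lambda>w. g (pick w))"
      using measurable_compose[OF pick g] by (rule P.integrable_const_bound)
    have "(\<integral>x. g x \<partial>?\<nu>) = (\<integral>w. g (pick w) \<partial>(\<mu> \<Otimes>\<^sub>M coin))"
      by (rule integral_distr[OF pick g])
    also have "\<dots> = (\<integral>x. (\<integral>b. g (pick (x, b)) \<partial>coin) \<partial>\<mu>)"
      using integral_fst'[OF int2] by simp
    also have "\<dots> = (\<integral>x. (1 - t) * g x + t * g z \<partial>\<mu>)"
      unfolding coin_def using t
      by (subst lebesgue_integral_point_measure_finite) (auto simp: UNIV_bool pick_def)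
    also have "\<dots> = (1 - t) * (\<integral>x. g x \<partial>\<mu>) + t * g z * measure \<mu> (space \<mu>)"
      using int by simp
    finally show "(\<integral>x. g x \<partial>?\<nu>) = (1 - t) * (\<integral>x. g x \<partial>\<mu>) + t * g z" using mass by simp
  qed
qed

lemma borel_measurable_continuous_on_sets:
  fixes g :: "'a::t2_space \<Rightarrow> real"
  assumes "sets \<mu> = sets (restrict_space borel K)" "continuous_on K g"
  shows "g \<in> borel_measurable \<mu>"
  using borel_measurable_continuous_on_restrict[OF assms(2)] measurable_cong_sets[OF assms(1) refl] by blast

lemma bounded_on_compact:
  fixes g :: "'a::topological_space \<Rightarrow> real"
  assumes "compact K" "continuous_on K g"
  obtains B where "\<And>x. x \<in> K \<Longrightarrow> \<bar>g x\<bar> \<le> B"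
  using compact_imp_bounded[OF compact_continuous_image[OF assms(2,1)]]
  by (auto simp: bounded_iff)

lemma integrable_on_compact:
  fixes g :: "'a::t2_space \<Rightarrow> real"
  assumes "compact K" and sets: "sets \<mu> = sets (restrict_space borel K)" and fin: "finite_measure \<mu>"
    and g: "continuous_on K g"
  shows "integrable \<mu> g"
proof -
  obtain B where B: "\<And>x. x \<in> K \<Longrightarrow> \<bar>g x\<bar> \<le> B"
    using bounded_on_compact[OF assms(1) g] by blast
  have "space \<mu> = K" using sets_eq_imp_space_eq[OF sets] by (simp add: space_restrict_space)
  then have "AE x in \<mu>. norm (g x) \<le> B" using B by (intro AE_I2) simp
  then show ?thesis
    using borel_measurable_continuous_on_sets[OF sets g] by (rule finite_measure.integrable_const_bound[OF fin])
qed

section \<open>Homogenised vectors and the Schur complement\<close>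

lemma continuous_on_homog: "continuous_on S homog"
proof -
  have "continuous_on S (\<lambda>y :: real ^ 'a. case k of Inl i \<Rightarrow> y $ i | Inr _ \<Rightarrow> 1)" for k :: "'a + unit"
    by (cases k) (auto intro!: continuous_intros)
  then show ?thesis unfolding homog_def by (intro continuous_on_vec_lambda)
qed

lemma continuous_on_dehomog: "continuous_on S dehomog"
  unfolding dehomog_def by (intro continuous_on_vec_lambda continuous_intros)

lemma dehomog_homog [simp]: "dehomog (homog y) = y"
  by (simp add: dehomog_def homog_def vec_eq_iff)

lemma compact_homog: "compact C \<Longrightarrow> compact (homog ` C)"
  by (intro compact_continuous_image continuous_on_homog)

text \<open>
  The block vector \<open>[a, b]\<close>. Unlike \<open>homog\<close> it allows an arbitrary last coordinate, which is
  needed to describe the action of a block matrix.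
\<close>
definition append_coord :: "real ^ 'n \<Rightarrow> real \<Rightarrow> real ^ ('n + unit)" where
  "append_coord a b = (\<chi> k. case k of Inl i \<Rightarrow> a $ i | Inr _ \<Rightarrow> b)"

lemma append_coord_nth [simp]: "append_coord a b $ Inl i = a $ i" "append_coord a b $ Inr u = b"
  by (simp_all add: append_coord_def)

lemma homog_append_coord: "homog y = append_coord y 1"
  by (simp add: homog_def append_coord_def)

lemma sum_UNIV_plus_unit: "(\<Sum>k\<in>UNIV. g k) = (\<Sum>i\<in>UNIV. g (Inl i)) + g (Inr ())"
  for g :: "'n::finite + unit \<Rightarrow> real"
proof -
  have "(\<Sum>k\<in>UNIV. g k) = (\<Sum>k\<in>UNIV <+> UNIV. g k)" by simp
  also have "\<dots> = (\<Sum>i\<in>UNIV. g (Inl i)) + (\<Sum>u\<in>UNIV. g (Inr u))"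
    by (subst sum.Plus) (simp_all add: o_def)
  finally show ?thesis by (simp add: UNIV_unit)
qed

lemma inner_append_coord: "append_coord a b \<bullet> append_coord c d = a \<bullet> c + b * d"
  by (simp add: inner_vec_def sum_UNIV_plus_unit)

text \<open>
  The last row without its diagonal entry. For the moment matrix of a probability
  measure on homogenised vectors it is the mean.
\<close>
definition last_row :: "real ^ ('n + unit) ^ ('n + unit) \<Rightarrow> real ^ 'n" where
  "last_row M = (\<chi> i. M $ Inr () $ Inl i)"

text \<open>
  The Schur complement of the last diagonal entry, for matrices in which that entry is 1. For the
  moment matrix of a probability measure on homogenised vectors it is the covariance matrix.
\<close>
definition schur_complement :: "real ^ ('n + unit) ^ ('n + unit) \<Rightarrow> real ^ 'n ^ 'n" where
  "schur_complement M = (\<chi> i j. M $ Inl i $ Inl j) - outer (last_row M) (last_row M)"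

text \<open>
  The decomposition \<open>M = diag (R, 0) + [m, 1] [m, 1]\<^sup>T\<close> with Schur complement \<open>R\<close> and last row
  \<open>[m, 1]\<close>, applied to a block vector.
\<close>
lemma mult_append_coord:
  assumes "transpose M = M" "M $ Inr () $ Inr () = 1"
  shows "M *v append_coord a b =
    append_coord (schur_complement M *v a + (last_row M \<bullet> a + b) *\<^sub>R last_row M) (last_row M \<bullet> a + b)"
proof -
  have sym: "M $ i $ j = M $ j $ i" for i j
    using arg_cong[OF assms(1), of "\<lambda>A. A $ j $ i"] by (simp add: transpose_def)
  have "(M *v append_coord a b) $ k =
    append_coord (schur_complement M *v a + (last_row M \<bullet> a + b) *\<^sub>R last_row M) (last_row M \<bullet> a + b) $ k"
    for k
  proof (cases k)
    case (Inl i)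
    have "(schur_complement M *v a) $ i =
        (\<Sum>j\<in>UNIV. M $ Inl i $ Inl j * a $ j) - (last_row M \<bullet> a) * last_row M $ i"
      unfolding schur_complement_def matrix_vector_mult_diff_rdistrib outer_vector_mult
      by (simp add: matrix_vector_mult_def)
    then show ?thesis
      unfolding Inl by (simp add: matrix_vector_mult_def sum_UNIV_plus_unit last_row_def
          sym[of "Inl i" "Inr ()"] algebra_simps)
  next
    case (Inr u)
    then show ?thesis
      by (simp add: matrix_vector_mult_def sum_UNIV_plus_unit last_row_def inner_vec_def assms(2))
  qed
  then show ?thesis by (simp add: vec_eq_iff)
qed

text \<open>
  The form \<open>a \<bullet> R a\<close> of the Schur complement \<open>R\<close> is the form of \<open>M\<close> at the vector \<open>[a, - m \<bullet> a]\<close>,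
  where \<open>m\<close> is the last row.
\<close>
lemma sym_pos_def_schur:
  assumes M: "sym_pos_def M" and M1: "M $ Inr () $ Inr () = 1"
  shows "sym_pos_def (schur_complement M)"
proof -
  note sym = sym_pos_defD(1)[OF M]
  have "transpose (schur_complement M) = schur_complement M"
    using sym by (simp add: schur_complement_def transpose_def outer_def vec_eq_iff mult.commute)
  moreover have "0 < a \<bullet> (schur_complement M *v a)" if "a \<noteq> 0" for a
  proof -
    let ?w = "append_coord a (- (last_row M \<bullet> a))"
    have "?w \<noteq> 0"
    proof
      assume "?w = 0"
      then have "a $ i = 0" for i using append_coord_nth(1)[of a "- (last_row M \<bullet> a)" i] by simp
      then show False using that by (simp add: vec_eq_iff)
    qed
    from sym_pos_defD(2)[OF M this] show ?thesis
      by (simp add: mult_append_coord[OF sym M1] inner_append_coord)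
  qed
  ultimately show ?thesis by (simp add: sym_pos_def_def)
qed

text \<open>
  Block inversion, \<open>z\<^sup>T M\<inverse> z = (y - m)\<^sup>T R\<inverse> (y - m) + 1\<close> for \<open>z = [y, 1]\<close>, with \<open>x\<close> in the
  role of \<open>M\<inverse> z\<close>.
\<close>
lemma inverse_quadratic_form_schur:
  assumes M: "sym_pos_def M" and M1: "M $ Inr () $ Inr () = 1"
  obtains x where "M *v x = homog y"
    "homog y \<bullet> x = (y - last_row M) \<bullet> (matrix_inv (schur_complement M) *v (y - last_row M)) + 1"
proof -
  define a where "a = matrix_inv (schur_complement M) *v (y - last_row M)"
  have a: "schur_complement M *v a = y - last_row M"
    unfolding a_def by (intro mult_matrix_inv_vector sym_pos_def_invertible sym_pos_def_schur[OF M M1])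
  let ?x = "append_coord a (1 - last_row M \<bullet> a)"
  have "M *v ?x = homog y"
    by (simp add: mult_append_coord[OF sym_pos_defD(1)[OF M] M1] a homog_append_coord)
  moreover have "homog y \<bullet> ?x = (y - last_row M) \<bullet> a + 1"
    by (simp add: homog_append_coord inner_append_coord inner_diff_left)
  ultimately show ?thesis using that unfolding a_def by blast
qed

section \<open>Moments of a feasible measure\<close>

lemma moment_matrix_nth: "moment_matrix \<mu> $ i $ j = (\<integral>z. z $ i * z $ j \<partial>\<mu>)"
  by (simp add: moment_matrix_def mat_integral_def outer_def)

lemma measure_feasibleD:
  fixes C :: "(real ^ 'n) set"
  assumes "measure_feasible C \<mu>"
  shows "sets \<mu> = sets (restrict_space borel (homog ` C))" "finite_measure \<mu>"
    "space \<mu> = homog ` C" "measure \<mu> (space \<mu>) = 1" "sym_pos_def (moment_matrix \<mu>)"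
proof -
  show sets: "sets \<mu> = sets (restrict_space borel (homog ` C))" and "finite_measure \<mu>"
    and "measure \<mu> (space \<mu>) = 1" "sym_pos_def (moment_matrix \<mu>)"
    using assms by (simp_all add: measure_feasible_def regular_measure_on_def)
  show "space \<mu> = homog ` C" using sets_eq_imp_space_eq[OF sets] by (simp add: space_restrict_space)
qed

lemma moment_matrix_last:
  assumes "measure_feasible C \<mu>"
  shows "moment_matrix \<mu> $ Inr () $ Inr () = 1"
    and "last_row (moment_matrix \<mu>) $ i = (\<integral>z. z $ Inl i \<partial>\<mu>)"
proof -
  note D = measure_feasibleD[OF assms]
  have one: "z $ Inr () = 1" if "z \<in> space \<mu>" for z using that by (auto simp: D(3) homog_def)
  have "moment_matrix \<mu> $ Inr () $ Inr () = (\<integral>z. 1 \<partial>\<mu>)"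
    unfolding moment_matrix_nth by (rule Bochner_Integration.integral_cong) (simp_all add: one)
  also have "\<dots> = 1" by (simp add: D(4))
  finally show "moment_matrix \<mu> $ Inr () $ Inr () = 1" .
  show "last_row (moment_matrix \<mu>) $ i = (\<integral>z. z $ Inl i \<partial>\<mu>)"
    unfolding last_row_def vec_lambda_beta moment_matrix_nth
    by (rule Bochner_Integration.integral_cong) (simp_all add: one)
qed

lemma integral_base_measure:
  fixes g :: "real ^ 'n \<Rightarrow> real"
  assumes \<mu>: "measure_feasible C \<mu>" and g: "continuous_on C g"
  shows "(\<integral>y. g y \<partial>base_measure C \<mu>) = (\<integral>z. g (dehomog z) \<partial>\<mu>)"
proof -
  note D = measure_feasibleD[OF \<mu>]
  have "dehomog \<in> borel_measurable \<mu>"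
    unfolding measurable_cong_sets[OF D(1) refl]
    by (intro borel_measurable_continuous_on_restrict continuous_on_dehomog)
  moreover have "dehomog \<in> space \<mu> \<rightarrow> C" by (auto simp: D(3))
  ultimately have "dehomog \<in> measurable \<mu> (restrict_space borel C)"
    by (intro measurable_restrict_space2)
  then show ?thesis unfolding base_measure_def
    by (rule integral_distr) (rule borel_measurable_continuous_on_restrict[OF g])
qed

text \<open>
  So the two integrals from which the candidate ellipsoid is built are blocks of the moment matrix of
  the homogenised measure.
\<close>
lemma base_measure_moments:
  assumes "measure_feasible C \<mu>"
  shows "vec_integral (base_measure C \<mu>) (\<lambda>y. y) = last_row (moment_matrix \<mu>)"
    and "mat_integral (base_measure C \<mu>) (\<lambda>y. outer y y)
           = (\<chi> i j. moment_matrix \<mu> $ Inl i $ Inl j)"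
proof -
  have "(\<integral>y. y $ i \<partial>base_measure C \<mu>) = (\<integral>z. z $ Inl i \<partial>\<mu>)" for i
    by (subst integral_base_measure[OF assms]) (auto simp: dehomog_def intro!: continuous_intros)
  then show "vec_integral (base_measure C \<mu>) (\<lambda>y. y) = last_row (moment_matrix \<mu>)"
    by (simp add: vec_integral_def moment_matrix_last[OF assms] vec_eq_iff)
  have "(\<integral>y. y $ i * y $ j \<partial>base_measure C \<mu>) = (\<integral>z. z $ Inl i * z $ Inl j \<partial>\<mu>)" for i j
    by (subst integral_base_measure[OF assms]) (auto simp: dehomog_def intro!: continuous_intros)
  then show "mat_integral (base_measure C \<mu>) (\<lambda>y. outer y y)
           = (\<chi> i j. moment_matrix \<mu> $ Inl i $ Inl j)"
    by (simp add: mat_integral_def outer_def moment_matrix_nth vec_eq_iff)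
qed

section \<open>Optimality of the measure yields the ellipsoid constraint\<close>

text \<open>
  The limit \<open>t \<rightarrow> 0\<close> gives \<open>s\<^sup>2 \<le> N s\<close>, which can be divided by \<open>s\<close> if \<open>s > 0\<close>.
\<close>
lemma quadratic_bound_limit:
  fixes s N :: real
  assumes "\<And>t. 0 < t \<Longrightarrow> t < 1 \<Longrightarrow> s\<^sup>2 \<le> N * ((1 - t) * s + t * s\<^sup>2)" and "0 \<le> N"
  shows "s \<le> N"
proof -
  have "((\<lambda>t. N * ((1 - t) * s + t * s\<^sup>2)) \<longlongrightarrow> N * ((1 - 0) * s + 0 * s\<^sup>2)) (at_right 0)"
    by (intro tendsto_intros)
  moreover have "\<forall>\<^sub>F t in at_right 0. s\<^sup>2 \<le> N * ((1 - t) * s + t * s\<^sup>2)"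
    using assms(1) by (auto simp: eventually_at_right[of 0 1] intro!: exI[of _ 1])
  ultimately have "s\<^sup>2 \<le> N * ((1 - 0) * s + 0 * s\<^sup>2)"
    by (intro tendsto_lowerbound) auto
  then have "s * s \<le> N * s" by (simp add: power2_eq_square)
  then show ?thesis using \<open>0 \<le> N\<close> by (cases "0 < s") auto
qed

text \<open>
  First-order optimality: with \<open>x = M\<inverse> z\<close> the claim is \<open>z\<^sup>T M\<inverse> z \<le> n + 1\<close>. Moving mass \<open>t\<close> to \<open>z\<close>
  cannot increase the determinant, and the trace inequality turns this into
  \<open>z \<bullet> w \<le> n + 1\<close> for \<open>w = M\<^sub>t\<inverse> z\<close>. Cauchy-Schwarz with respect to \<open>M\<^sub>t\<close> passes from \<open>w\<close> to
  \<open>x\<close> at the price of the factor \<open>x \<bullet> M\<^sub>t x\<close>, which tends to \<open>x \<bullet> M x = z \<bullet> x\<close>.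
\<close>
lemma optimal_measure_support_bound:
  fixes C :: "(real ^ 'n) set"
  assumes C: "compact C" and opt: "measure_optimal C \<mu>" and y: "y \<in> C"
    and x: "moment_matrix \<mu> *v x = homog y"
  shows "homog y \<bullet> x \<le> real CARD('n) + 1"
proof (rule quadratic_bound_limit)
  fix t :: real assume t: "0 < t" "t < 1"
  define z where "z = homog y"
  define M where "M = moment_matrix \<mu>"
  define s where "s = z \<bullet> x"
  define N where "N = real CARD('n) + 1"
  have \<mu>: "measure_feasible C \<mu>" using opt by (simp add: measure_optimal_def is_arg_max_def)
  note D = measure_feasibleD[OF \<mu>, folded M_def]
  have z: "z \<in> space \<mu>" using y by (simp add: D(3) z_def)
  obtain \<nu> where \<nu>: "sets \<nu> = sets \<mu>" "finite_measure \<nu>"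
    and \<nu>_int: "\<And>(g :: _ \<Rightarrow> real) B. g \<in> borel_measurable \<mu> \<Longrightarrow> (\<And>x. x \<in> space \<mu> \<Longrightarrow> \<bar>g x\<bar> \<le> B) \<Longrightarrow>
       (\<integral>x. g x \<partial>\<nu>) = (1 - t) * (\<integral>x. g x \<partial>\<mu>) + t * g z"
    using mixture_with_point_mass[OF D(2) D(4) z] t by (metis less_eq_real_def)
  have \<nu>_cont: "(\<integral>x. g x \<partial>\<nu>) = (1 - t) * (\<integral>x. g x \<partial>\<mu>) + t * g z"
    if g: "continuous_on (homog ` C) g" for g :: "_ \<Rightarrow> real"
  proof -
    obtain B where "\<And>x. x \<in> homog ` C \<Longrightarrow> \<bar>g x\<bar> \<le> B"
      using bounded_on_compact[OF compact_homog[OF C] g] by blast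
    then show ?thesis
      using \<nu>_int borel_measurable_continuous_on_sets[OF D(1) g] D(3) by blast
  qed
  define Mt where "Mt = (1 - t) *\<^sub>R M + t *\<^sub>R outer z z"
  have mom: "moment_matrix \<nu> = Mt"
    by (simp add: vec_eq_iff moment_matrix_nth \<nu>_cont continuous_intros Mt_def M_def outer_def)
  have Mt_mult: "Mt *v u = (1 - t) *\<^sub>R (M *v u) + (t * (z \<bullet> u)) *\<^sub>R z" for u
    by (simp add: Mt_def matrix_vector_mult_add_rdistrib outer_vector_mult flip: scaleR_matrix_vector_assoc)
  have Mt: "sym_pos_def Mt"
    unfolding sym_pos_def_def
  proof (intro conjI allI impI)
    show "transpose Mt = Mt"
      using sym_pos_defD(1)[OF D(5)]
      by (simp add: Mt_def transpose_def outer_def vec_eq_iff mult.commute)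
    fix u :: "real ^ ('n + unit)" assume "u \<noteq> 0"
    from sym_pos_defD(2)[OF D(5) this] have "0 < (1 - t) * (u \<bullet> (M *v u)) + t * (z \<bullet> u)\<^sup>2"
      using t by (intro add_pos_nonneg) auto
    then show "0 < u \<bullet> (Mt *v u)"
      by (simp add: Mt_mult inner_add_right inner_commute[of u z] power2_eq_square mult.assoc)
  qed
  have "(\<integral>z. 1 \<partial>\<nu>) = (1::real)"
    by (subst \<nu>_cont) (simp_all add: D(4))
  moreover have "regular_measure_on (homog ` C) \<nu>"
    using compact_imp_closed[OF compact_homog[OF C]] \<nu> D(1)
    by (intro finite_borel_measure_regular_on) auto
  ultimately have "measure_feasible C \<nu>" by (simp add: measure_feasible_def mom Mt)
  then have "logdet Mt \<le> logdet M"
    using opt mom unfolding measure_optimal_def is_arg_max_def M_def by (metis linorder_not_less)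
  then have "0 \<le> trace (matrix_inv Mt ** M) - real CARD('n + unit)"
    using logdet_diff_le_trace(1)[OF Mt D(5)] by linarith
  then have trM: "N \<le> trace (matrix_inv Mt ** M)" by (simp add: N_def)
  define w where "w = matrix_inv Mt *v z"
  note inv = sym_pos_def_invertible[OF Mt]
  have w: "Mt *v w = z" unfolding w_def by (rule mult_matrix_inv_vector[OF inv])
  \<comment> \<open>Expanding one factor \<open>Mt\<close> of the identity matrix isolates \<open>z \<bullet> w\<close>.\<close>
  have "N = trace (matrix_inv Mt ** Mt)" by (simp add: matrix_inv_left[OF inv] trace_I N_def)
  also have "\<dots> = (1 - t) * trace (matrix_inv Mt ** M) + t * (z \<bullet> w)"
    by (simp add: Mt_def[THEN arg_cong, of "\<lambda>A. matrix_inv Mt ** A"] matrix_add_ldistrib trace_add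
        matrix_scalar_ac trace_scaleR trace_mult_outer w_def
        flip: scalar_matrix_assoc)
  finally have "N = (1 - t) * trace (matrix_inv Mt ** M) + t * (z \<bullet> w)" .
  moreover have "(1 - t) * N \<le> (1 - t) * trace (matrix_inv Mt ** M)"
    using trM t by (intro mult_left_mono) auto
  ultimately have "t * (z \<bullet> w) \<le> t * N" by (simp add: algebra_simps)
  then have zw: "z \<bullet> w \<le> N" using t by simp
  have "(x \<bullet> (Mt *v w))\<^sup>2 \<le> (x \<bullet> (Mt *v x)) * (w \<bullet> (Mt *v w))"
    using sym_pos_defD[OF Mt] by (intro Cauchy_Schwarz_psd_on_subspace[of UNIV]) auto
  also have "\<dots> \<le> (x \<bullet> (Mt *v x)) * N"
    using zw sym_pos_defD(3)[OF Mt] by (intro mult_left_mono) (auto simp: w inner_commute)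
  finally have "s\<^sup>2 \<le> N * (x \<bullet> (Mt *v x))" by (simp add: w s_def inner_commute mult.commute)
  also have "x \<bullet> (Mt *v x) = (1 - t) * s + t * s\<^sup>2"
    using x by (simp add: Mt_mult s_def M_def z_def inner_add_right inner_commute[of x] power2_eq_square)
  finally show "(homog y \<bullet> x)\<^sup>2 \<le> (real CARD('n) + 1) * ((1 - t) * (homog y \<bullet> x) + t * (homog y \<bullet> x)\<^sup>2)"
    by (simp add: s_def N_def z_def)
qed simp

section \<open>Weak duality\<close>

text \<open>
  The decomposition of a mean squared distance into a covariance part and the squared offset of \<open>c\<close>
  from the mean, for the form given by \<open>A\<close>.
\<close>
lemma mean_quadratic_form:
  fixes C :: "(real ^ 'n) set" and A :: "real ^ 'n ^ 'n"
  assumes C: "compact C" and \<mu>: "measure_feasible C \<mu>"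
  defines "m \<equiv> last_row (moment_matrix \<mu>)"
  shows "(\<integral>z. (dehomog z - c) \<bullet> (A *v (dehomog z - c)) \<partial>\<mu>)
    = trace (A ** schur_complement (moment_matrix \<mu>)) + (m - c) \<bullet> (A *v (m - c))"
proof -
  note D = measure_feasibleD[OF \<mu>]
  define M where "M = moment_matrix \<mu>"
  interpret finite_measure \<mu> by (rule D(2))
  have int: "integrable \<mu> g" if "continuous_on (homog ` C) g" for g :: "_ \<Rightarrow> real"
    using integrable_on_compact[OF compact_homog[OF C] D(1,2) that] .
  have entry: "(\<integral>z. (z $ Inl i - c $ i) * (z $ Inl j - c $ j) \<partial>\<mu>) =
      schur_complement M $ j $ i + (m - c) $ i * (m - c) $ j" for i j
  proof -
    have "(\<integral>z. (z $ Inl i - c $ i) * (z $ Inl j - c $ j) \<partial>\<mu>) =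
      (\<integral>z. z $ Inl j * z $ Inl i - c $ j * z $ Inl i - c $ i * z $ Inl j + c $ i * c $ j \<partial>\<mu>)"
      by (simp add: algebra_simps)
    also have "\<dots> = M $ Inl j $ Inl i - c $ j * m $ i - c $ i * m $ j + c $ i * c $ j"
      using D(4) by (simp add: int continuous_intros M_def moment_matrix_nth m_def moment_matrix_last[OF \<mu>])
    finally show ?thesis by (simp add: schur_complement_def outer_def m_def M_def algebra_simps)
  qed
  have "(\<integral>z. (dehomog z - c) \<bullet> (A *v (dehomog z - c)) \<partial>\<mu>)
    = (\<integral>z. (\<Sum>i\<in>UNIV. \<Sum>j\<in>UNIV. A $ i $ j * ((z $ Inl i - c $ i) * (z $ Inl j - c $ j))) \<partial>\<mu>)"
    by (simp add: inner_vec_def matrix_vector_mult_def dehomog_def sum_distrib_left mult_ac)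
  also have "\<dots> = (\<Sum>i\<in>UNIV. \<Sum>j\<in>UNIV. A $ i $ j * (\<integral>z. (z $ Inl i - c $ i) * (z $ Inl j - c $ j) \<partial>\<mu>))"
    by (simp add: int continuous_intros)
  also have "\<dots> = (\<Sum>i\<in>UNIV. \<Sum>j\<in>UNIV. A $ i $ j * schur_complement M $ j $ i)
      + (\<Sum>i\<in>UNIV. \<Sum>j\<in>UNIV. A $ i $ j * ((m - c) $ i * (m - c) $ j))"
    unfolding entry by (simp only: distrib_left sum.distrib)
  also have "(\<Sum>i\<in>UNIV. \<Sum>j\<in>UNIV. A $ i $ j * schur_complement M $ j $ i) = trace (A ** schur_complement M)"
    by (simp add: trace_def matrix_matrix_mult_def)
  also have "(\<Sum>i\<in>UNIV. \<Sum>j\<in>UNIV. A $ i $ j * ((m - c) $ i * (m - c) $ j)) = (m - c) \<bullet> (A *v (m - c))"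
    by (simp add: inner_vec_def matrix_vector_mult_def sum_distrib_left mult_ac)
  finally show ?thesis by (simp add: M_def)
qed

text \<open>
  The constraint holds pointwise on \<open>C\<close>, so its mean over \<open>\<mu>\<close> is at most \<open>n\<close>. This
  bounds \<open>trace (P\<inverse> R)\<close> by \<open>n\<close> minus the offset term \<open>q\<close>, and the trace inequality converts that
  bound into one for the log-determinants.
\<close>
lemma feasible_ellipsoid_logdet:
  fixes C :: "(real ^ 'n) set"
  assumes C: "compact C" and \<mu>: "measure_feasible C \<mu>" and feas: "ellipsoid_feasible C (P, c)"
  defines "R \<equiv> schur_complement (moment_matrix \<mu>)" and "m \<equiv> last_row (moment_matrix \<mu>)"
  shows "logdet R \<le> logdet P" and "logdet R = logdet P \<Longrightarrow> P = R \<and> c = m"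
proof -
  note D = measure_feasibleD[OF \<mu>]
  interpret finite_measure \<mu> by (rule D(2))
  have P: "sym_pos_def P"
    and bound: "\<And>y. y \<in> C \<Longrightarrow> (y - c) \<bullet> (matrix_inv P *v (y - c)) \<le> real CARD('n)"
    using feas by (auto simp: ellipsoid_feasible_def)
  have R: "sym_pos_def R"
    unfolding R_def by (rule sym_pos_def_schur[OF D(5) moment_matrix_last(1)[OF \<mu>]])
  define q where "q = (m - c) \<bullet> (matrix_inv P *v (m - c))"
  have cont: "continuous_on (homog ` C) (\<lambda>z. (dehomog z - c) \<bullet> (matrix_inv P *v (dehomog z - c)))"
    by (intro continuous_intros continuous_on_dehomog
        continuous_on_compose2[OF matrix_vector_mult_linear_continuous_on[of UNIV]]) auto
  have "(\<integral>z. (dehomog z - c) \<bullet> (matrix_inv P *v (dehomog z - c)) \<partial>\<mu>) \<le> (\<integral>z. real CARD('n) \<partial>\<mu>)"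
    using bound by (intro integral_mono integrable_on_compact[OF compact_homog[OF C] D(1,2) cont])
      (auto simp: D(3))
  then have tr: "trace (matrix_inv P ** R) + q \<le> real CARD('n)"
    unfolding mean_quadratic_form[OF C \<mu>] by (simp add: D(4) R_def q_def m_def)
  note invP = sym_pos_def_matrix_inv[OF P]
  have q: "0 \<le> q" unfolding q_def by (rule sym_pos_defD(3)[OF invP])
  note key = logdet_diff_le_trace[OF P R]
  show "logdet R \<le> logdet P" using key(1) tr q by linarith
  assume eq: "logdet R = logdet P"
  then have "q = 0" using key(1) tr q by linarith
  then have "m - c = 0" using sym_pos_defD(2)[OF invP, of "m - c"] unfolding q_def by force
  moreover have "P = R" using key tr q eq by (intro key(2)) linarith
  ultimately show "P = R \<and> c = m" by simp
qed

theorem proposition4p1: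
  fixes f :: "real ^ 'q \<Rightarrow> real ^ 'n"
    and y0 :: "real ^ 'q" and P0 :: "real ^ 'q ^ 'q"
    and C :: "(real ^ 'n) set"
    and \<mu> :: "(real ^ ('n + unit)) measure"
    and yopt :: "real ^ 'n" and Popt :: "real ^ 'n ^ 'n"
  assumes "sym_pos_def P0"
    and "continuous_on (ellipsoid y0 P0) f"
    and "C = f ` ellipsoid y0 P0"
    and "measure_optimal C \<mu>"
    and "yopt = vec_integral (base_measure C \<mu>) (\<lambda>y. y)"
    and "Popt = mat_integral (base_measure C \<mu>) (\<lambda>y. outer y y) - outer yopt yopt"
  shows "\<forall>P c. ellipsoid_optimal C (P, c) \<longleftrightarrow> P = Popt \<and> c = yopt"
proof -
  have C: "compact C"
    unfolding assms(3) by (rule compact_continuous_image[OF assms(2) compact_ellipsoid[OF assms(1)]])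
  have \<mu>: "measure_feasible C \<mu>" using assms(4) by (simp add: measure_optimal_def is_arg_max_def)
  define M where "M = moment_matrix \<mu>"
  note D = measure_feasibleD[OF \<mu>, folded M_def] and M1 = moment_matrix_last(1)[OF \<mu>, folded M_def]
  have yopt: "yopt = last_row M" unfolding assms(5) base_measure_moments[OF \<mu>] M_def ..
  have Popt: "Popt = schur_complement M"
    unfolding assms(6) base_measure_moments[OF \<mu>] yopt schur_complement_def M_def ..
  have "(y - yopt) \<bullet> (matrix_inv Popt *v (y - yopt)) \<le> real CARD('n)" if "y \<in> C" for y
  proof -
    obtain x where "M *v x = homog y"
      "homog y \<bullet> x = (y - yopt) \<bullet> (matrix_inv Popt *v (y - yopt)) + 1"
      using inverse_quadratic_form_schur[OF D(5) M1] unfolding yopt Popt by blast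
    then show ?thesis
      using optimal_measure_support_bound[OF C assms(4) that, of x] by (simp add: M_def)
  qed
  then have feas: "ellipsoid_feasible C (Popt, yopt)"
    using sym_pos_def_schur[OF D(5) M1] by (simp add: ellipsoid_feasible_def Popt)
  note lower = feasible_ellipsoid_logdet[OF C \<mu>, folded M_def, folded Popt yopt]
  have "ellipsoid_optimal C (P, c) \<longleftrightarrow> P = Popt \<and> c = yopt" for P c
  proof
    assume "ellipsoid_optimal C (P, c)"
    then have Pc: "ellipsoid_feasible C (P, c)" and "\<not> logdet Popt < logdet P"
      using feas by (auto simp: ellipsoid_optimal_def is_arg_min_def)
    then show "P = Popt \<and> c = yopt" using lower(1)[OF Pc] lower(2)[OF Pc] by linarith
  next
    assume "P = Popt \<and> c = yopt"
    then show "ellipsoid_optimal C (P, c)"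
      using feas lower(1) by (auto simp: ellipsoid_optimal_def is_arg_min_def not_less)
  qed
  then show ?thesis by blast
qed

end
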